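(* Let $R$ be an inner McCoy ring and let $S$ be a multiplicatively closed subset of $R$ consisting only of central regular elements of $R$. Then the localization $S^{-1}R$ is inner McCoy.
   Context: All rings are associative with unity. An element is regular if it is neither a left nor a right zero divisor. For a ring $A$, $A[x]$ denotes the polynomial ring in an indeterminate $x$ commuting with $A$. A ring $A$ is inner McCoy if for every pair $f(x), g(x) \in A[x]\setminus\{0\}$ with $f(x)g(x)f(x) = 0$ there exists $r \in A\setminus\{0\}$ such that $f(x)\, r\, f(x) = 0$. *)

theory Defs
  imports "HOL-Algebra.UnivPoly"
begin

text \<open>
  Rings are the (not necessarily commutative, unital) rings of HOL-Algebra.  The polynomial ring
  \<^term>\<open>UP A\<close> is available for every ring, with the indeterminate commuting with the coefficients;
  \<^term>\<open>monom (UP A) r 0\<close> is \<open>r\<close> regarded as a constant polynomial.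
\<close>

definition inner_mccoy :: "('a, 'm) ring_scheme \<Rightarrow> bool" where
  "inner_mccoy A \<longleftrightarrow> ring A \<and>
    (\<forall>f \<in> carrier (UP A) - {\<zero>\<^bsub>UP A\<^esub>}. \<forall>g \<in> carrier (UP A) - {\<zero>\<^bsub>UP A\<^esub>}.
       f \<otimes>\<^bsub>UP A\<^esub> g \<otimes>\<^bsub>UP A\<^esub> f = \<zero>\<^bsub>UP A\<^esub> \<longrightarrow>
       (\<exists>r \<in> carrier A - {\<zero>\<^bsub>A\<^esub>}.
          f \<otimes>\<^bsub>UP A\<^esub> monom (UP A) r 0 \<otimes>\<^bsub>UP A\<^esub> f = \<zero>\<^bsub>UP A\<^esub>))"

definition left_zero_divisor :: "('a, 'm) ring_scheme \<Rightarrow> 'a \<Rightarrow> bool" where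
  "left_zero_divisor R a \<longleftrightarrow> a \<in> carrier R \<and> (\<exists>b \<in> carrier R - {\<zero>\<^bsub>R\<^esub>}. a \<otimes>\<^bsub>R\<^esub> b = \<zero>\<^bsub>R\<^esub>)"

definition right_zero_divisor :: "('a, 'm) ring_scheme \<Rightarrow> 'a \<Rightarrow> bool" where
  "right_zero_divisor R a \<longleftrightarrow> a \<in> carrier R \<and> (\<exists>b \<in> carrier R - {\<zero>\<^bsub>R\<^esub>}. b \<otimes>\<^bsub>R\<^esub> a = \<zero>\<^bsub>R\<^esub>)"

definition regular_element :: "('a, 'm) ring_scheme \<Rightarrow> 'a \<Rightarrow> bool" where
  "regular_element R a \<longleftrightarrow>
     a \<in> carrier R \<and> \<not> left_zero_divisor R a \<and> \<not> right_zero_divisor R a"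

definition central_element :: "('a, 'm) ring_scheme \<Rightarrow> 'a \<Rightarrow> bool" where
  "central_element R a \<longleftrightarrow> a \<in> carrier R \<and> (\<forall>b \<in> carrier R. a \<otimes>\<^bsub>R\<^esub> b = b \<otimes>\<^bsub>R\<^esub> a)"

text \<open>
  Only nonemptiness is required, not \<open>\<one> \<in> S\<close>; sets containing \<open>\<one>\<close> are a special case.
\<close>

definition mult_closed_subset :: "'a set \<Rightarrow> ('a, 'm) ring_scheme \<Rightarrow> bool" where
  "mult_closed_subset S R \<longleftrightarrow>
     S \<subseteq> carrier R \<and> S \<noteq> {} \<and> (\<forall>s \<in> S. \<forall>t \<in> S. s \<otimes>\<^bsub>R\<^esub> t \<in> S)"

text \<open>
  The localization at a multiplicatively closed set \<open>S\<close> of central elements: the pair \<open>(a, s)\<close>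
  stands for the fraction \<open>s\<^sup>-\<^sup>1 a\<close>, and \<open>a/s = b/t\<close> iff \<open>u (a t - b s) = 0\<close> for some
  \<open>u \<in> S\<close>.  The operations are defined by taking the union over all representatives.  Zero and
  one are the classes of \<open>0/s\<close> and \<open>s/s\<close>, which do not depend on \<open>s \<in> S\<close>.
\<close>

definition frac_rel :: "'a set \<Rightarrow> ('a, 'm) ring_scheme \<Rightarrow> (('a \<times> 'a) \<times> ('a \<times> 'a)) set" where
  "frac_rel S R =
     {((a, s), (b, t)) | a s b t. a \<in> carrier R \<and> s \<in> S \<and> b \<in> carrier R \<and> t \<in> S \<and>
        (\<exists>u \<in> S. u \<otimes>\<^bsub>R\<^esub> (a \<otimes>\<^bsub>R\<^esub> t \<ominus>\<^bsub>R\<^esub> b \<otimes>\<^bsub>R\<^esub> s) = \<zero>\<^bsub>R\<^esub>)}"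

definition localization :: "'a set \<Rightarrow> ('a, 'm) ring_scheme \<Rightarrow> ('a \<times> 'a) set ring" where
  "localization S R =
    \<lparr>carrier = (carrier R \<times> S) // frac_rel S R,
     mult = (\<lambda>X Y. \<Union>(a, s) \<in> X. \<Union>(b, t) \<in> Y. frac_rel S R `` {(a \<otimes>\<^bsub>R\<^esub> b, s \<otimes>\<^bsub>R\<^esub> t)}),
     one = (\<Union>s \<in> S. frac_rel S R `` {(s, s)}),
     zero = (\<Union>s \<in> S. frac_rel S R `` {(\<zero>\<^bsub>R\<^esub>, s)}),
     add = (\<lambda>X Y. \<Union>(a, s) \<in> X. \<Union>(b, t) \<in> Y.
              frac_rel S R `` {((a \<otimes>\<^bsub>R\<^esub> t) \<oplus>\<^bsub>R\<^esub> (b \<otimes>\<^bsub>R\<^esub> s), s \<otimes>\<^bsub>R\<^esub> t)})\<rparr>"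

end

theory Submission
  imports Defs "HOL-Algebra.Multiplicative_Group"
begin

text \<open>
  Only finitely many coefficients of a polynomial over the localization are nonzero, so they can
  be written over a single denominator: every such \<open>f\<close> is \<open>s\<^sup>-\<^sup>1 F\<close> with \<open>F\<close> a polynomial over \<open>R\<close>
  and \<open>s \<in> S\<close> (\<open>clear_denominators\<close>).  Denominators are central, so products of polynomials
  written this way are computed on numerators, \<open>(s\<^sup>-\<^sup>1 F) (t\<^sup>-\<^sup>1 G) = (s t)\<^sup>-\<^sup>1 F G\<close>
  (\<open>quotient_poly_mult\<close>); denominators are regular, so \<open>s\<^sup>-\<^sup>1 F = 0\<close> exactly when \<open>F = 0\<close>
  (\<open>quotient_poly_zero_iff\<close>).

  Hence, if \<open>f = s\<^sup>-\<^sup>1 F\<close> and \<open>g = t\<^sup>-\<^sup>1 G\<close> are nonzero with \<open>f g f = 0\<close>, then \<open>F\<close> and \<open>G\<close> are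
  nonzero with \<open>F G F = 0\<close>.  The inner McCoy property of \<open>R\<close> yields \<open>r \<noteq> 0\<close> with
  \<open>F r F = 0\<close>, and the nonzero fraction \<open>s\<^sup>-\<^sup>1 r\<close> is a witness for \<open>f\<close>.
\<close>

section \<open>Fractions with central regular denominators\<close>

locale central_denominators = ring R for R (structure) +
  fixes S :: "'a set"
  assumes S_carrier: "S \<subseteq> carrier R"
    and S_nonempty: "S \<noteq> {}"
    and S_mult: "\<lbrakk>s \<in> S; t \<in> S\<rbrakk> \<Longrightarrow> s \<otimes> t \<in> S"
    and S_commute: "\<lbrakk>s \<in> S; x \<in> carrier R\<rbrakk> \<Longrightarrow> s \<otimes> x = x \<otimes> s"
    and S_regular: "\<lbrakk>s \<in> S; x \<in> carrier R; s \<otimes> x = \<zero>\<rbrakk> \<Longrightarrow> x = \<zero>"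
begin

abbreviation L where "L \<equiv> localization S R"

definition frac :: "'a \<Rightarrow> 'a \<Rightarrow> ('a \<times> 'a) set" where
  "frac a s = frac_rel S R `` {(a, s)}"

lemma S_closed [simp]: "s \<in> S \<Longrightarrow> s \<in> carrier R"
  using S_carrier by auto

lemma S_right_commute:
  assumes "x \<in> carrier R" "s \<in> S" "y \<in> carrier R"
  shows "x \<otimes> s \<otimes> y = x \<otimes> y \<otimes> s"
  using assms S_commute[of s y] by (simp add: m_assoc)

lemma S_middle_commute:
  assumes "a \<in> carrier R" "b \<in> carrier R" "s \<in> S" "t \<in> carrier R"
  shows "(a \<otimes> b) \<otimes> (s \<otimes> t) = (a \<otimes> s) \<otimes> (b \<otimes> t)"
  using assms S_right_commute[of a s b] by (simp add: m_assoc[symmetric])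

lemma S_mult_cancel:
  assumes s: "s \<in> S" and x: "x \<in> carrier R" and y: "y \<in> carrier R"
    and eq: "x \<otimes> s = y \<otimes> s"
  shows "x = y"
proof -
  have "s \<otimes> (x \<ominus> y) = s \<otimes> x \<ominus> s \<otimes> y"
    using s x y by (simp add: minus_eq r_distr r_minus)
  also have "\<dots> = \<zero>"
    using s x y eq S_commute[of s x] S_commute[of s y] by (simp add: r_neg minus_eq)
  finally show ?thesis
    using S_regular[OF s, of "x \<ominus> y"] x y by simp
qed

text \<open>
  Regularity cancels the auxiliary factor \<open>u\<close> from the definition of the relation, so equality of
  fractions is plain cross multiplication and the numerator over a given denominator is unique.
\<close>

lemma frac_rel_iff:
  "((a, s), (b, t)) \<in> frac_rel S R \<longleftrightarrow>
     a \<in> carrier R \<and> s \<in> S \<and> b \<in> carrier R \<and> t \<in> S \<and> a \<otimes> t = b \<otimes> s"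
proof -
  have "(\<exists>u\<in>S. u \<otimes> (a \<otimes> t \<ominus> b \<otimes> s) = \<zero>) \<longleftrightarrow> a \<otimes> t = b \<otimes> s"
    if c: "a \<in> carrier R" "s \<in> S" "b \<in> carrier R" "t \<in> S"
  proof
    assume "\<exists>u\<in>S. u \<otimes> (a \<otimes> t \<ominus> b \<otimes> s) = \<zero>"
    then obtain u where "u \<in> S" "u \<otimes> (a \<otimes> t \<ominus> b \<otimes> s) = \<zero>"
      by (rule bexE)
    then have "a \<otimes> t \<ominus> b \<otimes> s = \<zero>"
      using c S_regular[of u "a \<otimes> t \<ominus> b \<otimes> s"] by simp
    then show "a \<otimes> t = b \<otimes> s"
      using c by simp
  next
    assume "a \<otimes> t = b \<otimes> s"
    then have "s \<otimes> (a \<otimes> t \<ominus> b \<otimes> s) = \<zero>"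
      using c by (simp add: r_neg minus_eq)
    then show "\<exists>u\<in>S. u \<otimes> (a \<otimes> t \<ominus> b \<otimes> s) = \<zero>"
      using c(2) by (rule bexI)
  qed
  then show ?thesis
    unfolding frac_rel_def by (simp cong: conj_cong)
qed

lemma equiv_frac_rel: "equiv (carrier R \<times> S) (frac_rel S R)"
proof (rule equivI)
  show "frac_rel S R \<subseteq> (carrier R \<times> S) \<times> (carrier R \<times> S)"
    by (auto simp: frac_rel_def)
  show "refl_on (carrier R \<times> S) (frac_rel S R)"
    by (auto simp: refl_on_def frac_rel_iff)
  show "sym (frac_rel S R)"
    by (auto simp: sym_def frac_rel_iff)
  show "trans (frac_rel S R)"
  proof (rule transI, clarify)
    fix a s b t c v
    assume "((a, s), b, t) \<in> frac_rel S R" "((b, t), c, v) \<in> frac_rel S R"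
    then have cl: "a \<in> carrier R" "b \<in> carrier R" "c \<in> carrier R" "s \<in> S" "t \<in> S" "v \<in> S"
      and 1: "a \<otimes> t = b \<otimes> s" and 2: "b \<otimes> v = c \<otimes> t"
      by (auto simp: frac_rel_iff)
    have "(a \<otimes> v) \<otimes> t = (b \<otimes> s) \<otimes> v"
      using cl by (simp add: S_right_commute[of a v t] 1)
    also have "\<dots> = (c \<otimes> t) \<otimes> s"
      using cl by (simp add: S_right_commute[of b s v] 2)
    also have "\<dots> = (c \<otimes> s) \<otimes> t"
      using cl by (simp add: S_right_commute[of c t s])
    finally have "a \<otimes> v = c \<otimes> s"
      using cl by (intro S_mult_cancel[of t "a \<otimes> v" "c \<otimes> s"]) simp_all
    then show "((a, s), c, v) \<in> frac_rel S R"
      using cl by (simp add: frac_rel_iff)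
  qed
qed

lemma frac_eq_iff:
  assumes "a \<in> carrier R" "s \<in> S" "b \<in> carrier R" "t \<in> S"
  shows "frac a s = frac b t \<longleftrightarrow> a \<otimes> t = b \<otimes> s"
  using assms eq_equiv_class_iff[OF equiv_frac_rel, of "(a, s)" "(b, t)"]
  by (simp add: frac_def frac_rel_iff)

lemma frac_eq_iff_same_denom:
  assumes "a \<in> carrier R" "b \<in> carrier R" "s \<in> S"
  shows "frac a s = frac b s \<longleftrightarrow> a = b"
  using assms S_mult_cancel by (auto simp: frac_eq_iff)

lemma frac_expand:
  assumes "a \<in> carrier R" "s \<in> S" "t \<in> S"
  shows "frac (a \<otimes> t) (s \<otimes> t) = frac a s"
  using assms S_commute[of t s] by (simp add: frac_eq_iff S_mult m_assoc)

lemma carrier_localization: "carrier L = {frac a s | a s. a \<in> carrier R \<and> s \<in> S}"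
  by (auto simp: localization_def frac_def quotient_def)

lemma frac_closed [simp]: "\<lbrakk>a \<in> carrier R; s \<in> S\<rbrakk> \<Longrightarrow> frac a s \<in> carrier L"
  by (auto simp: carrier_localization)

lemma zero_localization: assumes "s \<in> S" shows "\<zero>\<^bsub>L\<^esub> = frac \<zero> s"
proof -
  have "(\<Union>t\<in>S. frac \<zero> t) = (\<Union>t\<in>S. frac \<zero> s)"
    using assms by (intro SUP_cong refl) (simp add: frac_eq_iff)
  then show ?thesis
    using S_nonempty by (simp add: localization_def frac_def)
qed

lemma one_localization: assumes "s \<in> S" shows "\<one>\<^bsub>L\<^esub> = frac s s"
proof -
  have "(\<Union>t\<in>S. frac t t) = (\<Union>t\<in>S. frac s s)"
    using assms by (intro SUP_cong refl) (simp add: frac_eq_iff S_commute)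
  then show ?thesis
    using S_nonempty by (simp add: localization_def frac_def)
qed

lemma frac_mult:
  assumes "a \<in> carrier R" "s \<in> S" "b \<in> carrier R" "t \<in> S"
  shows "frac a s \<otimes>\<^bsub>L\<^esub> frac b t = frac (a \<otimes> b) (s \<otimes> t)"
proof -
  have "congruent2 (frac_rel S R) (frac_rel S R) (\<lambda>(a, s) (b, t). frac (a \<otimes> b) (s \<otimes> t))"
  proof (rule congruent2I', clarify)
    fix a s a' s' b t b' t'
    assume "((a, s), a', s') \<in> frac_rel S R" "((b, t), b', t') \<in> frac_rel S R"
    then have cl: "a \<in> carrier R" "a' \<in> carrier R" "b \<in> carrier R" "b' \<in> carrier R"
        "s \<in> S" "s' \<in> S" "t \<in> S" "t' \<in> S"
      and 1: "a \<otimes> s' = a' \<otimes> s" and 2: "b \<otimes> t' = b' \<otimes> t"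
      by (auto simp: frac_rel_iff)
    have "(a \<otimes> b) \<otimes> (s' \<otimes> t') = (a \<otimes> s') \<otimes> (b \<otimes> t')"
      using cl by (intro S_middle_commute) simp_all
    also have "\<dots> = (a' \<otimes> b') \<otimes> (s \<otimes> t)"
      unfolding 1 2 using cl by (intro S_middle_commute[symmetric]) simp_all
    finally show "frac (a \<otimes> b) (s \<otimes> t) = frac (a' \<otimes> b') (s' \<otimes> t')"
      using cl by (simp add: frac_eq_iff S_mult)
  qed
  from UN_equiv_class2[OF equiv_frac_rel equiv_frac_rel this, of "(a, s)" "(b, t)"]
  show ?thesis
    using assms by (simp add: localization_def frac_def case_prod_unfold)
qed

lemma frac_add_cross:
  assumes "a \<in> carrier R" "s \<in> S" "b \<in> carrier R" "t \<in> S"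
  shows "frac a s \<oplus>\<^bsub>L\<^esub> frac b t = frac (a \<otimes> t \<oplus> b \<otimes> s) (s \<otimes> t)"
proof -
  have "congruent2 (frac_rel S R) (frac_rel S R)
          (\<lambda>(a, s) (b, t). frac (a \<otimes> t \<oplus> b \<otimes> s) (s \<otimes> t))"
  proof (rule congruent2I', clarify)
    fix a s a' s' b t b' t'
    assume "((a, s), a', s') \<in> frac_rel S R" "((b, t), b', t') \<in> frac_rel S R"
    then have cl: "a \<in> carrier R" "a' \<in> carrier R" "b \<in> carrier R" "b' \<in> carrier R"
        "s \<in> S" "s' \<in> S" "t \<in> S" "t' \<in> S"
      and 1: "a \<otimes> s' = a' \<otimes> s" and 2: "b \<otimes> t' = b' \<otimes> t"
      by (auto simp: frac_rel_iff)
    have "(a \<otimes> t) \<otimes> (s' \<otimes> t') = (a' \<otimes> s) \<otimes> (t \<otimes> t')"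
      using cl by (simp add: S_middle_commute[of a t s' t'] 1)
    also have "\<dots> = (a' \<otimes> t') \<otimes> (s \<otimes> t)"
      using cl by (simp add: S_commute[of t t'] S_middle_commute[of a' s t' t])
    finally have A: "(a \<otimes> t) \<otimes> (s' \<otimes> t') = (a' \<otimes> t') \<otimes> (s \<otimes> t)" .
    have "(b \<otimes> s) \<otimes> (s' \<otimes> t') = (b' \<otimes> t) \<otimes> (s \<otimes> s')"
      using cl by (simp add: S_commute[of s' t'] S_middle_commute[of b s t' s'] 2)
    also have "\<dots> = (b' \<otimes> s') \<otimes> (s \<otimes> t)"
      using cl by (simp add: S_commute[of s s'] S_commute[of s t] S_middle_commute[of b' t s' s])
    finally have B: "(b \<otimes> s) \<otimes> (s' \<otimes> t') = (b' \<otimes> s') \<otimes> (s \<otimes> t)" .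
    show "frac (a \<otimes> t \<oplus> b \<otimes> s) (s \<otimes> t) = frac (a' \<otimes> t' \<oplus> b' \<otimes> s') (s' \<otimes> t')"
      using cl A B by (simp add: frac_eq_iff S_mult l_distr)
  qed
  from UN_equiv_class2[OF equiv_frac_rel equiv_frac_rel this, of "(a, s)" "(b, t)"]
  show ?thesis
    using assms by (simp add: localization_def frac_def case_prod_unfold)
qed

lemma frac_add:
  assumes "a \<in> carrier R" "b \<in> carrier R" "s \<in> S"
  shows "frac a s \<oplus>\<^bsub>L\<^esub> frac b s = frac (a \<oplus> b) s"
  using assms frac_expand[of "a \<oplus> b" s s] by (simp add: frac_add_cross l_distr)

section \<open>The localization is a ring\<close>

lemma common_denominator2:
  assumes "x \<in> carrier L" "y \<in> carrier L"
  obtains a b s where "a \<in> carrier R" "b \<in> carrier R" "s \<in> S" "x = frac a s" "y = frac b s"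
proof -
  obtain a s b t where *: "a \<in> carrier R" "s \<in> S" "b \<in> carrier R" "t \<in> S"
    "x = frac a s" "y = frac b t"
    using assms by (auto simp: carrier_localization)
  have "x = frac (a \<otimes> t) (s \<otimes> t)" "y = frac (b \<otimes> s) (s \<otimes> t)"
    using * frac_expand[of a s t] frac_expand[of b t s] by (simp_all add: S_commute)
  then show ?thesis
    using that[of "a \<otimes> t" "b \<otimes> s" "s \<otimes> t"] * S_mult by simp
qed

lemma common_denominator3:
  assumes "x \<in> carrier L" "y \<in> carrier L" "z \<in> carrier L"
  obtains a b c s where "a \<in> carrier R" "b \<in> carrier R" "c \<in> carrier R" "s \<in> S"
    "x = frac a s" "y = frac b s" "z = frac c s"
proof -
  obtain a b s where 1: "a \<in> carrier R" "b \<in> carrier R" "s \<in> S" "x = frac a s" "y = frac b s"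
    using common_denominator2 assms by blast
  obtain c t where 2: "c \<in> carrier R" "t \<in> S" "z = frac c t"
    using assms by (auto simp: carrier_localization)
  have "x = frac (a \<otimes> t) (s \<otimes> t)" "y = frac (b \<otimes> t) (s \<otimes> t)" "z = frac (c \<otimes> s) (s \<otimes> t)"
    using 1 2 frac_expand[of a s t] frac_expand[of b s t] frac_expand[of c t s]
    by (simp_all add: S_commute)
  then show ?thesis
    using that[of "a \<otimes> t" "b \<otimes> t" "c \<otimes> s" "s \<otimes> t"] 1 2 S_mult by simp
qed

text \<open>
  Over a common denominator both operations act on numerators alone, so every ring axiom reduces
  to the same axiom for \<open>R\<close>.
\<close>

lemma ring_localization: "ring L"
proof (rule ringI)
  obtain d where d: "d \<in> S" using S_nonempty by auto
  show "abelian_group L"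
  proof (rule abelian_groupI)
    fix x y assume "x \<in> carrier L" "y \<in> carrier L"
    then obtain a b s where "a \<in> carrier R" "b \<in> carrier R"
        "s \<in> S" "x = frac a s" "y = frac b s"
      by (rule common_denominator2)
    then show "x \<oplus>\<^bsub>L\<^esub> y \<in> carrier L" "x \<oplus>\<^bsub>L\<^esub> y = y \<oplus>\<^bsub>L\<^esub> x"
      by (simp_all add: frac_add a_comm)
  next
    show "\<zero>\<^bsub>L\<^esub> \<in> carrier L"
      using d by (simp add: zero_localization)
  next
    fix x y z assume "x \<in> carrier L" "y \<in> carrier L" "z \<in> carrier L"
    then obtain a b c s where "a \<in> carrier R" "b \<in> carrier R" "c \<in> carrier R"
        "s \<in> S" "x = frac a s" "y = frac b s" "z = frac c s"
      by (rule common_denominator3)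
    then show "x \<oplus>\<^bsub>L\<^esub> y \<oplus>\<^bsub>L\<^esub> z = x \<oplus>\<^bsub>L\<^esub> (y \<oplus>\<^bsub>L\<^esub> z)"
      by (simp_all add: frac_add a_assoc)
  next
    fix x assume "x \<in> carrier L"
    then obtain a s where x: "a \<in> carrier R" "s \<in> S" "x = frac a s"
      by (auto simp: carrier_localization)
    then show "\<zero>\<^bsub>L\<^esub> \<oplus>\<^bsub>L\<^esub> x = x"
      by (simp add: zero_localization frac_add)
    show "\<exists>y\<in>carrier L. y \<oplus>\<^bsub>L\<^esub> x = \<zero>\<^bsub>L\<^esub>"
      using x by (intro bexI[of _ "frac (\<ominus> a) s"])
        (simp_all add: zero_localization frac_add l_neg)
  qed
  show "monoid L"
  proof (rule monoidI)
    fix x y assume "x \<in> carrier L" "y \<in> carrier L"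
    then obtain a b s where "a \<in> carrier R" "b \<in> carrier R"
        "s \<in> S" "x = frac a s" "y = frac b s"
      by (rule common_denominator2)
    then show "x \<otimes>\<^bsub>L\<^esub> y \<in> carrier L"
      by (simp_all add: frac_mult S_mult)
  next
    show "\<one>\<^bsub>L\<^esub> \<in> carrier L"
      using d by (simp add: one_localization)
  next
    fix x y z assume "x \<in> carrier L" "y \<in> carrier L" "z \<in> carrier L"
    then obtain a b c s where "a \<in> carrier R" "b \<in> carrier R" "c \<in> carrier R"
        "s \<in> S" "x = frac a s" "y = frac b s" "z = frac c s"
      by (rule common_denominator3)
    then show "x \<otimes>\<^bsub>L\<^esub> y \<otimes>\<^bsub>L\<^esub> z = x \<otimes>\<^bsub>L\<^esub> (y \<otimes>\<^bsub>L\<^esub> z)"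
      by (simp_all add: frac_mult S_mult m_assoc)
  next
    fix x assume "x \<in> carrier L"
    then obtain a s where x: "a \<in> carrier R" "s \<in> S" "x = frac a s"
      by (auto simp: carrier_localization)
    then show "\<one>\<^bsub>L\<^esub> \<otimes>\<^bsub>L\<^esub> x = x" "x \<otimes>\<^bsub>L\<^esub> \<one>\<^bsub>L\<^esub> = x"
      by (simp_all add: one_localization frac_mult frac_expand S_commute)
  qed
  fix x y z assume "x \<in> carrier L" "y \<in> carrier L" "z \<in> carrier L"
  then obtain a b c s where "a \<in> carrier R" "b \<in> carrier R" "c \<in> carrier R"
      "s \<in> S" "x = frac a s" "y = frac b s" "z = frac c s"
    by (rule common_denominator3)
  then show "(x \<oplus>\<^bsub>L\<^esub> y) \<otimes>\<^bsub>L\<^esub> z = x \<otimes>\<^bsub>L\<^esub> z \<oplus>\<^bsub>L\<^esub> y \<otimes>\<^bsub>L\<^esub> z"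
    "z \<otimes>\<^bsub>L\<^esub> (x \<oplus>\<^bsub>L\<^esub> y) = z \<otimes>\<^bsub>L\<^esub> x \<oplus>\<^bsub>L\<^esub> z \<otimes>\<^bsub>L\<^esub> y"
    by (simp_all add: frac_add frac_mult S_mult l_distr r_distr)
qed

section \<open>Polynomials over the localization\<close>

sublocale P: UP_ring R "UP R"
  by unfold_locales simp

sublocale LP: UP_ring L "UP L"
  using ring_localization by (simp add: UP_ring_def)

text \<open>
  The relation \<open>f = s\<^sup>-\<^sup>1 F\<close>.  A relation is used because \<open>F\<close> and \<open>s\<close> are not determined by \<open>f\<close>,
  and the arguments below need only some pair of this kind.
\<close>

definition quotient_poly :: "(nat \<Rightarrow> ('a \<times> 'a) set) \<Rightarrow> (nat \<Rightarrow> 'a) \<Rightarrow> 'a \<Rightarrow> bool" where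
  "quotient_poly f F s \<longleftrightarrow>
     f \<in> carrier (UP L) \<and> F \<in> carrier (UP R) \<and> s \<in> S \<and>
     (\<forall>n. coeff (UP L) f n = frac (coeff (UP R) F n) s)"

lemma finsum_frac:
  assumes "finite I" "\<And>i. i \<in> I \<Longrightarrow> a i \<in> carrier R" "s \<in> S"
  shows "(\<Oplus>\<^bsub>L\<^esub>i\<in>I. frac (a i) s) = frac (\<Oplus>i\<in>I. a i) s"
  using assms
proof (induction I)
  case empty
  then show ?case by (simp add: zero_localization)
next
  case (insert j I)
  then show ?case
    by (simp add: Pi_def frac_add)
qed

text \<open>
  All summands of a convolution coefficient have the same denominator \<open>s t\<close>, so the sum can be
  taken on numerators.
\<close>

lemma quotient_poly_mult:
  assumes f: "quotient_poly f F s" and g: "quotient_poly g G t"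
  shows "quotient_poly (f \<otimes>\<^bsub>UP L\<^esub> g) (F \<otimes>\<^bsub>UP R\<^esub> G) (s \<otimes> t)"
proof -
  have "coeff (UP L) (f \<otimes>\<^bsub>UP L\<^esub> g) n = frac (coeff (UP R) (F \<otimes>\<^bsub>UP R\<^esub> G) n) (s \<otimes> t)" for n
    using f g unfolding quotient_poly_def
    by (simp add: frac_mult finsum_frac S_mult)
  then show ?thesis
    using f g by (simp add: quotient_poly_def S_mult)
qed

lemma quotient_poly_zero_iff:
  assumes f: "quotient_poly f F s"
  shows "f = \<zero>\<^bsub>UP L\<^esub> \<longleftrightarrow> F = \<zero>\<^bsub>UP R\<^esub>"
proof -
  have c: "f \<in> carrier (UP L)" "F \<in> carrier (UP R)" "s \<in> S"
    and co: "\<And>n. coeff (UP L) f n = frac (coeff (UP R) F n) s"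
    using f by (auto simp: quotient_poly_def)
  have "f = \<zero>\<^bsub>UP L\<^esub> \<longleftrightarrow> (\<forall>n. coeff (UP L) f n = \<zero>\<^bsub>L\<^esub>)"
    using c LP.up_eqI[of f "\<zero>\<^bsub>UP L\<^esub>"] by auto
  also have "\<dots> \<longleftrightarrow> (\<forall>n. coeff (UP R) F n = \<zero>)"
    using c by (simp add: co zero_localization[of s] frac_eq_iff_same_denom)
  also have "\<dots> \<longleftrightarrow> F = \<zero>\<^bsub>UP R\<^esub>"
    using c P.up_eqI[of F "\<zero>\<^bsub>UP R\<^esub>"] by auto
  finally show ?thesis .
qed

text \<open>
  Constants are covered by the same relation, which lets the product \<open>f r f\<close> be transferred with
  \<open>quotient_poly_mult\<close> just like \<open>f g f\<close>.
\<close>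

lemma quotient_poly_const:
  assumes "r \<in> carrier R" "s \<in> S"
  shows "quotient_poly (monom (UP L) (frac r s) 0) (monom (UP R) r 0) s"
  using assms by (simp add: quotient_poly_def zero_localization[of s])

lemma common_denominator_lessThan:
  fixes f :: "nat \<Rightarrow> ('a \<times> 'a) set"
  assumes "\<And>i. f i \<in> carrier L"
  shows "\<exists>s\<in>S. \<exists>F. \<forall>i<n. F i \<in> carrier R \<and> f i = frac (F i) s"
proof (induction n)
  case 0
  then show ?case using S_nonempty by auto
next
  case (Suc n)
  then obtain s F where s: "s \<in> S" and F: "\<And>i. i < n \<Longrightarrow> F i \<in> carrier R \<and> f i = frac (F i) s"
    by blast
  obtain a t where a: "a \<in> carrier R" "t \<in> S" "f n = frac a t"
    using assms[of n] by (auto simp: carrier_localization)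
  let ?F = "\<lambda>i. if i < n then F i \<otimes> t else a \<otimes> s"
  have "?F i \<in> carrier R \<and> f i = frac (?F i) (s \<otimes> t)" if "i < Suc n" for i
  proof (cases "i < n")
    case True
    then show ?thesis using F[of i] s a frac_expand[of "F i" s t] by simp
  next
    case False
    then have "i = n" using that by simp
    then show ?thesis using s a frac_expand[of a t s] by (simp add: S_commute)
  qed
  moreover have "s \<otimes> t \<in> S"
    using s a S_mult by simp
  ultimately show ?case
    by (intro bexI[of _ "s \<otimes> t"] exI[of _ ?F]) simp_all
qed

text \<open>
  Numerators exist over one denominator up to any given index; beyond the degree the numerator
  has to be \<open>0\<close>, so truncating there loses nothing and makes \<open>F\<close> a polynomial.
\<close>

lemma clear_denominators:
  assumes f: "f \<in> carrier (UP L)"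
  obtains F s where "quotient_poly f F s"
proof -
  obtain n where n: "\<And>m. n < m \<Longrightarrow> coeff (UP L) f m = \<zero>\<^bsub>L\<^esub>"
    using LP.deg_aboveD[OF _ f] by blast
  obtain s F where s: "s \<in> S"
    and F: "\<And>i. i < Suc n \<Longrightarrow> F i \<in> carrier R \<and> coeff (UP L) f i = frac (F i) s"
    using common_denominator_lessThan[of "coeff (UP L) f" "Suc n"] f by auto
  define G where "G i = (if i < Suc n then F i else \<zero>)" for i
  have G: "G \<in> carrier (UP R)"
    using F by (auto simp: UP_def up_def G_def bound_def intro!: exI[of _ n])
  then have "coeff (UP R) G i = G i" for i
    by (simp add: UP_def)
  moreover have "coeff (UP L) f i = frac (G i) s" for i
    using F[of i] n[of i] s by (simp add: G_def zero_localization[of s])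
  ultimately have "quotient_poly f G s"
    using f G s by (simp add: quotient_poly_def)
  then show ?thesis by (rule that)
qed

end

section \<open>Localizing an inner McCoy ring\<close>

theorem theorem5p3:
  fixes R :: "('a, 'm) ring_scheme" and S :: "'a set"
  assumes "inner_mccoy R"
    and "mult_closed_subset S R"
    and "\<forall>s \<in> S. central_element R s \<and> regular_element R s"
  shows "inner_mccoy (localization S R)"
proof -
  interpret ring R
    using assms(1) by (simp add: inner_mccoy_def)
  interpret central_denominators R S
  proof
    show "S \<subseteq> carrier R" "S \<noteq> {}"
      using assms(2) by (auto simp: mult_closed_subset_def)
    show "s \<otimes>\<^bsub>R\<^esub> t \<in> S" if "s \<in> S" "t \<in> S" for s t
      using assms(2) that by (simp add: mult_closed_subset_def)
    show "s \<otimes>\<^bsub>R\<^esub> x = x \<otimes>\<^bsub>R\<^esub> s" if "s \<in> S" "x \<in> carrier R" for s x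
      using assms(3) that by (meson central_element_def)
    show "x = \<zero>\<^bsub>R\<^esub>" if "s \<in> S" "x \<in> carrier R" "s \<otimes>\<^bsub>R\<^esub> x = \<zero>\<^bsub>R\<^esub>" for s x
      using assms(3) that by (auto simp: regular_element_def left_zero_divisor_def)
  qed
  have "\<exists>r \<in> carrier L - {\<zero>\<^bsub>L\<^esub>}. f \<otimes>\<^bsub>UP L\<^esub> monom (UP L) r 0 \<otimes>\<^bsub>UP L\<^esub> f = \<zero>\<^bsub>UP L\<^esub>"
    if f: "f \<in> carrier (UP L)" "f \<noteq> \<zero>\<^bsub>UP L\<^esub>" and g: "g \<in> carrier (UP L)" "g \<noteq> \<zero>\<^bsub>UP L\<^esub>"
      and fgf: "f \<otimes>\<^bsub>UP L\<^esub> g \<otimes>\<^bsub>UP L\<^esub> f = \<zero>\<^bsub>UP L\<^esub>" for f g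
  proof -
    obtain F s where F: "quotient_poly f F s" using clear_denominators f(1) by blast
    obtain G t where G: "quotient_poly g G t" using clear_denominators g(1) by blast
    have s: "s \<in> S" using F by (simp add: quotient_poly_def)
    have nz: "F \<in> carrier (UP R) - {\<zero>\<^bsub>UP R\<^esub>}" "G \<in> carrier (UP R) - {\<zero>\<^bsub>UP R\<^esub>}"
      using F G f(2) g(2) quotient_poly_zero_iff by (auto simp: quotient_poly_def)
    have "F \<otimes>\<^bsub>UP R\<^esub> G \<otimes>\<^bsub>UP R\<^esub> F = \<zero>\<^bsub>UP R\<^esub>"
      using quotient_poly_zero_iff[OF quotient_poly_mult[OF quotient_poly_mult[OF F G] F]] fgf
      by simp
    then obtain r where r: "r \<in> carrier R" "r \<noteq> \<zero>\<^bsub>R\<^esub>"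
      and FrF: "F \<otimes>\<^bsub>UP R\<^esub> monom (UP R) r 0 \<otimes>\<^bsub>UP R\<^esub> F = \<zero>\<^bsub>UP R\<^esub>"
      using assms(1) nz unfolding inner_mccoy_def by blast
    have "f \<otimes>\<^bsub>UP L\<^esub> monom (UP L) (frac r s) 0 \<otimes>\<^bsub>UP L\<^esub> f = \<zero>\<^bsub>UP L\<^esub>"
      using quotient_poly_zero_iff[OF quotient_poly_mult[OF quotient_poly_mult[OF F
            quotient_poly_const[OF r(1) s]] F]] FrF
      by simp
    moreover have "frac r s \<in> carrier L - {\<zero>\<^bsub>L\<^esub>}"
      using r s by (simp add: zero_localization[of s] frac_eq_iff_same_denom)
    ultimately show ?thesis by blast
  qed
  then show ?thesis
    unfolding inner_mccoy_def using ring_localization by blast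
qed

end
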